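(* Algorithm TSRMB-1-Scenario provides an exact solution to the Two-Stage Robust Matching Bottleneck problem with a single scenario: for every instance $(R_1,S,D)$, the set $D_1$ it returns is an optimal solution of $$\min_{D_1\subseteq D,\ |D_1|=|R_1|}\big\{cost_1(D_1,R_1)+cost_2(D\setminus D_1,S)\big\}.$$
   Context: Setting: $D$ (drivers), $R_1$ (first-stage riders, $m=|R_1|\ge1$) and $S$ (the single scenario of second-stage riders, $S\neq\emptyset$) are finite disjoint sets, $d$ is a metric on $R_1\cup S\cup D$, and $|D|\ge|R_1|+|S|$. For $D_1\subseteq D$ with $|D_1|=|R_1|$, $cost_1(D_1,R_1)=\frac1m\sum_{(i,j)\in M_1}d(i,j)$, where $M_1$ is a minimum-weight perfect matching between $R_1$ and $D_1$. For a set of drivers $A$, $cost_2(A,S)$ is the bottleneck matching cost: the minimum, over all matchings of $A$ and $S$ covering every element of $S$, of the largest distance of a matched pair. Algorithm TSRMB-1-Scenario$(R_1,S,D)$: let $e_1,\dots,e_q$ be all the pairs in $D\times S$, with distances (weights) $w_1\le w_2\le\dots\le w_q$. For each $i=1,\dots,q$: - let $G_i$ be the bipartite graph with sides $R_1\cup S$ and $D$, whose edges are all pairs in $D\times R_1$ together with all pairs $(x,y)\in D\times S$ with $d(x,y)\le w_i$; edges between $D$ and $R_1$ have weight $d$, and edges between $D$ and $S$ have weight $0$; - let $M_i$ be a minimum-weight matching among the maximum-cardinality matchings of $G_i$; - if $M_i$ does not cover all of $R_1\cup S$, discard index $i$; otherwise let $D_1^i$ be the set of drivers matched to $R_1$ in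 $M_i$. Return a set $D_1$ minimizing $cost_1(D_1^i,R_1)+cost_2(D\setminus D_1^i,S)$ over all non-discarded indices $i$. *)

theory Defs
  imports "HOL-Analysis.Abstract_Metric_Spaces"
begin

text \<open>
  All graphs here are bipartite with drivers on one side and riders on the other, so an edge
  is an ordered pair (driver, rider).  The two sides are disjoint in every use, so a set of
  edges is a matching iff no driver and no rider occurs in two of its edges.
\<close>

type_synonym 'v edge = "'v \<times> 'v"

definition matching :: "'v edge set \<Rightarrow> 'v edge set \<Rightarrow> bool" where
  "matching E M \<longleftrightarrow> M \<subseteq> E \<and> inj_on fst M \<and> inj_on snd M"

definition covering_matching :: "'v set \<Rightarrow> 'v set \<Rightarrow> 'v edge set \<Rightarrow> bool" where
  "covering_matching A B M \<longleftrightarrow> matching (A \<times> B) M \<and> snd ` M = B"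

definition perfect_matching :: "'v set \<Rightarrow> 'v set \<Rightarrow> 'v edge set \<Rightarrow> bool" where
  "perfect_matching A B M \<longleftrightarrow> matching (A \<times> B) M \<and> fst ` M = A \<and> snd ` M = B"

definition min_weight_max_matching ::
  "'v edge set \<Rightarrow> ('v edge \<Rightarrow> real) \<Rightarrow> 'v edge set \<Rightarrow> bool" where
  "min_weight_max_matching E w M \<longleftrightarrow> is_arg_min (sum w) (is_arg_max card (matching E)) M"

text \<open>The choice of the minimum-weight perfect matching does not affect the value below.\<close>

definition cost1 :: "('v \<Rightarrow> 'v \<Rightarrow> real) \<Rightarrow> 'v set \<Rightarrow> 'v set \<Rightarrow> real" where
  "cost1 d D1 R1 =
     (let M1 = arg_min (sum (\<lambda>(x, y). d x y)) (perfect_matching D1 R1)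
      in 1 / real (card R1) * (\<Sum>(x, y)\<in>M1. d x y))"

text \<open>
  The inner maximum is meaningful for \<open>S \<noteq> {}\<close>, and the outer minimum when \<open>A\<close> and \<open>S\<close> are
  finite with \<open>card S \<le> card A\<close>.
\<close>

definition cost2 :: "('v \<Rightarrow> 'v \<Rightarrow> real) \<Rightarrow> 'v set \<Rightarrow> 'v set \<Rightarrow> real" where
  "cost2 d A S =
     Min ((\<lambda>M. Max ((\<lambda>(x, y). d x y) ` M)) ` {M. covering_matching A S M})"

definition total_cost ::
  "('v \<Rightarrow> 'v \<Rightarrow> real) \<Rightarrow> 'v set \<Rightarrow> 'v set \<Rightarrow> 'v set \<Rightarrow> 'v set \<Rightarrow> real" where
  "total_cost d R1 S D D1 = cost1 d D1 R1 + cost2 d (D - D1) S"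

definition optimal_solution ::
  "('v \<Rightarrow> 'v \<Rightarrow> real) \<Rightarrow> 'v set \<Rightarrow> 'v set \<Rightarrow> 'v set \<Rightarrow> 'v set \<Rightarrow> bool" where
  "optimal_solution d R1 S D D1 \<longleftrightarrow>
     is_arg_min (total_cost d R1 S D) (\<lambda>X. X \<subseteq> D \<and> card X = card R1) D1"

definition threshold_edges ::
  "('v \<Rightarrow> 'v \<Rightarrow> real) \<Rightarrow> 'v set \<Rightarrow> 'v set \<Rightarrow> 'v set \<Rightarrow> real \<Rightarrow> 'v edge set" where
  "threshold_edges d R1 S D w = D \<times> R1 \<union> {(x, y) \<in> D \<times> S. d x y \<le> w}"

definition threshold_weight ::
  "('v \<Rightarrow> 'v \<Rightarrow> real) \<Rightarrow> 'v set \<Rightarrow> 'v edge \<Rightarrow> real" where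
  "threshold_weight d R1 = (\<lambda>(x, y). if y \<in> R1 then d x y else 0)"

text \<open>
  The algorithm leaves open how ties are broken, both in sorting the pairs and in choosing the
  matchings, so it is modelled as a relation.  A run consists of an enumeration \<open>es\<close> of
  \<open>D \<times> S\<close> by nondecreasing distance and matchings \<open>Ms i\<close>, with indices counted from 0;
  only the values \<open>Ms i\<close> for \<open>i < length es\<close> matter.
\<close>

definition tsrmb_run ::
  "('v \<Rightarrow> 'v \<Rightarrow> real) \<Rightarrow> 'v set \<Rightarrow> 'v set \<Rightarrow> 'v set \<Rightarrow>
     'v edge list \<Rightarrow> (nat \<Rightarrow> 'v edge set) \<Rightarrow> bool" where
  "tsrmb_run d R1 S D es Ms \<longleftrightarrow>
     distinct es \<and> set es = D \<times> S \<and> sorted (map (\<lambda>(x, y). d x y) es) \<and>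
     (\<forall>i<length es.
        min_weight_max_matching
          (threshold_edges d R1 S D (case es ! i of (x, y) \<Rightarrow> d x y))
          (threshold_weight d R1) (Ms i))"

definition tsrmb_candidate ::
  "'v set \<Rightarrow> 'v set \<Rightarrow> 'v edge list \<Rightarrow> (nat \<Rightarrow> 'v edge set) \<Rightarrow> 'v set \<Rightarrow> bool" where
  "tsrmb_candidate R1 S es Ms X \<longleftrightarrow>
     (\<exists>i<length es. R1 \<union> S \<subseteq> snd ` Ms i \<and> X = {x. \<exists>y\<in>R1. (x, y) \<in> Ms i})"

definition tsrmb_returns ::
  "('v \<Rightarrow> 'v \<Rightarrow> real) \<Rightarrow> 'v set \<Rightarrow> 'v set \<Rightarrow> 'v set \<Rightarrow>
     'v edge list \<Rightarrow> (nat \<Rightarrow> 'v edge set) \<Rightarrow> 'v set \<Rightarrow> bool" where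
  "tsrmb_returns d R1 S D es Ms D1 \<longleftrightarrow>
     is_arg_min (total_cost d R1 S D) (tsrmb_candidate R1 S es Ms) D1"

end

theory Submission
  imports Defs
begin

text \<open>
  Fix a feasible \<open>X\<close>, a minimum-weight perfect matching \<open>M1\<close> of \<open>X\<close> and \<open>R1\<close>, and a bottleneck
  matching \<open>M2\<close> of \<open>D - X\<close> and \<open>S\<close>.  The bottleneck value is the distance \<open>w\<^sub>i\<close> of an edge of \<open>M2\<close>,
  so \<open>M1 \<union> M2\<close> is a matching of \<open>G\<^sub>i\<close> covering all riders.  Hence \<open>M\<^sub>i\<close> covers all riders and
  has weight at most that of \<open>M1\<close>.  The part of \<open>M\<^sub>i\<close> on \<open>R1\<close> bounds the first-stage cost of
  the \<open>i\<close>-th candidate and its part on \<open>S\<close> bounds the second-stage cost by \<open>w\<^sub>i\<close>, so this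
  candidate costs no more than \<open>X\<close>.
\<close>

section \<open>Finite families of matchings and matchings of maximum cardinality\<close>

lemma finite_matching: "finite E \<Longrightarrow> matching E M \<Longrightarrow> finite M"
  unfolding matching_def using finite_subset by blast

lemma finite_matchings: "finite E \<Longrightarrow> finite {M. matching E M}"
  by (rule finite_subset[of _ "Pow E"]) (auto simp: matching_def)

lemma ex_is_arg_min_Collect:
  fixes f :: "'a \<Rightarrow> 'b::linorder"
  assumes "finite {x. P x}" and "P a"
  shows "\<exists>x. is_arg_min f P x"
  using ex_is_arg_min_if_finite[of "{x. P x}" f] assms by auto

lemma ex_min_weight_max_matching:
  assumes "finite E"
  shows "\<exists>M. min_weight_max_matching E w M"
proof -
  let ?P = "\<lambda>M. is_arg_max card (matching E) M"
  have "matching E {}" by (simp add: matching_def)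
  moreover have "\<forall>M. matching E M \<longrightarrow> card M < Suc (card E)"
    using assms by (auto simp: matching_def less_Suc_eq_le intro: card_mono)
  ultimately obtain M where "matching E M" "\<forall>N. matching E N \<longrightarrow> card N \<le> card M"
    using ex_has_greatest_nat[of "matching E" "{}" card "Suc (card E)"] by metis
  then have "?P M" by (auto simp: is_arg_max_linorder)
  moreover have "finite {M. ?P M}"
    by (rule finite_subset[OF _ finite_matchings[OF assms]]) (auto simp: is_arg_max_def)
  ultimately show ?thesis
    unfolding min_weight_max_matching_def by (rule ex_is_arg_min_Collect[rotated])
qed

text \<open>A matching is injective on riders, so it has at most \<open>card V\<close> edges, and
  \<open>N\<close> attains this bound. Maximum cardinality therefore forces covering
  \<open>V\<close>, and \<open>N\<close> is one of the matchings among which \<open>M\<close> has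
  least weight.\<close>

lemma min_weight_max_matching_covers:
  assumes "finite E" and "snd ` E \<subseteq> V" and "finite V"
    and M: "min_weight_max_matching E w M" and N: "matching E N" "snd ` N = V"
  shows "snd ` M = V" and "sum w M \<le> sum w N"
proof -
  have bound: "card K \<le> card V" if "matching E K" for K
    by (rule card_inj_on_le[of snd]) (use that assms in \<open>auto simp: matching_def\<close>)
  have card_N: "card N = card V"
    using N card_image[of snd N] by (auto simp: matching_def)
  have M': "matching E M" "\<And>K. matching E K \<Longrightarrow> card K \<le> card M"
    using M by (auto simp: min_weight_max_matching_def is_arg_min_linorder is_arg_max_linorder)
  have "card (snd ` M) = card M"
    using M'(1) card_image by (auto simp: matching_def)
  then have "card V \<le> card (snd ` M)"
    using M'(2)[OF N(1)] card_N by simp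
  moreover have "snd ` M \<subseteq> V" using M'(1) assms(2) by (auto simp: matching_def)
  ultimately show "snd ` M = V" using card_seteq[OF assms(3)] by blast
  have "is_arg_max card (matching E) N"
    using N(1) bound card_N by (simp add: is_arg_max_linorder)
  then show "sum w M \<le> sum w N"
    using M by (simp add: min_weight_max_matching_def is_arg_min_linorder)
qed

section \<open>Existence of perfect and covering matchings; bounds on the two stage costs\<close>

lemma finite_perfect_matchings:
  assumes "finite A" and "finite B"
  shows "finite {M. perfect_matching A B M}"
  by (rule finite_subset[OF _ finite_matchings[of "A \<times> B"]])
    (use assms in \<open>auto simp: perfect_matching_def\<close>)

lemma finite_covering_matchings:
  assumes "finite A" and "finite B"
  shows "finite {M. covering_matching A B M}"
  by (rule finite_subset[OF _ finite_matchings[of "A \<times> B"]])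
    (use assms in \<open>auto simp: covering_matching_def\<close>)

lemma perfect_matching_exists:
  assumes "finite A" and "finite B" and "card A = card B"
  shows "\<exists>M. perfect_matching A B M"
proof -
  obtain f where f: "bij_betw f A B"
    using assms finite_same_card_bij by blast
  have "perfect_matching A B ((\<lambda>x. (x, f x)) ` A)"
    using f by (auto simp: perfect_matching_def matching_def inj_on_def bij_betw_def image_image)
  then show ?thesis ..
qed

lemma covering_matching_exists:
  assumes "finite A" and "finite B" and "card B \<le> card A"
  shows "\<exists>M. covering_matching A B M"
proof -
  obtain A' where A': "A' \<subseteq> A" "card A' = card B"
    using assms(3) by (meson obtain_subset_with_card_n)
  then obtain M where "perfect_matching A' B M"
    using perfect_matching_exists[of A' B] assms finite_subset by blast
  then have "covering_matching A B M"
    using A'(1) by (auto simp: perfect_matching_def covering_matching_def matching_def)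
  then show ?thesis ..
qed

text \<open>The choice operator \<open>arg_min\<close> in \<open>cost1\<close> is informative only
  once a minimizer exists. Equal cardinalities give a perfect matching, and there are finitely many,
  so the chosen one is a true minimizer.\<close>

lemma cost1_arg_min:
  assumes "finite A" and "finite B" and "card A = card B"
  obtains M where "is_arg_min (sum (\<lambda>(x, y). d x y)) (perfect_matching A B) M"
    and "cost1 d A B = 1 / real (card B) * (\<Sum>(x, y)\<in>M. d x y)"
proof -
  have "\<exists>M. is_arg_min (sum (\<lambda>(x, y). d x y)) (perfect_matching A B) M"
    using perfect_matching_exists[OF assms]
    by (elim exE) (rule ex_is_arg_min_Collect[OF finite_perfect_matchings[OF assms(1,2)]])
  then have "is_arg_min (sum (\<lambda>(x, y). d x y)) (perfect_matching A B)
      (arg_min (sum (\<lambda>(x, y). d x y)) (perfect_matching A B))"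
    unfolding arg_min_def by (rule someI_ex)
  then show thesis by (rule that) (simp add: cost1_def Let_def)
qed

lemma card_perfect_matching:
  assumes "perfect_matching A B M"
  shows "card A = card B"
  using assms card_image[of fst M] card_image[of snd M]
  by (auto simp: perfect_matching_def matching_def)

lemma cost1_le:
  assumes "finite A" and "finite B" and M: "perfect_matching A B M"
  shows "cost1 d A B \<le> 1 / real (card B) * (\<Sum>(x, y)\<in>M. d x y)"
proof -
  obtain N where N: "is_arg_min (sum (\<lambda>(x, y). d x y)) (perfect_matching A B) N"
    "cost1 d A B = 1 / real (card B) * (\<Sum>(x, y)\<in>N. d x y)"
    using cost1_arg_min[OF assms(1,2) card_perfect_matching[OF M]] .
  have "(\<Sum>(x, y)\<in>N. d x y) \<le> (\<Sum>(x, y)\<in>M. d x y)"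
    using N(1) M by (simp add: is_arg_min_linorder)
  then show ?thesis
    unfolding N(2) by (intro mult_left_mono) auto
qed

lemma cost2_attained:
  assumes "finite A" and "finite S" and "card S \<le> card A"
  obtains M where "covering_matching A S M"
    and "cost2 d A S = Max ((\<lambda>(x, y). d x y) ` M)"
proof -
  have "cost2 d A S \<in> (\<lambda>M. Max ((\<lambda>(x, y). d x y) ` M)) ` {M. covering_matching A S M}"
    unfolding cost2_def
    using finite_covering_matchings[OF assms(1,2)] covering_matching_exists[OF assms]
    by (intro Min_in) auto
  then show thesis using that by auto
qed

text \<open>The matching \<open>M\<close> is one competitor in the outer minimum. As
  \<open>S\<close> is nonempty, so is \<open>M\<close>, and its \<open>Max\<close> is then the
  distance of an actual edge.\<close>

lemma cost2_le:
  assumes "finite A" and "finite S" and "S \<noteq> {}" and M: "covering_matching A S M"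
    and "\<And>x y. (x, y) \<in> M \<Longrightarrow> d x y \<le> w"
  shows "cost2 d A S \<le> w"
proof -
  have "finite M"
    using M assms(1,2) finite_matching[of "A \<times> S"] by (auto simp: covering_matching_def)
  moreover have "M \<noteq> {}"
    using M assms(3) by (auto simp: covering_matching_def)
  ultimately have "Max ((\<lambda>(x, y). d x y) ` M) \<le> w"
    using assms(5) by auto
  moreover have "cost2 d A S \<le> Max ((\<lambda>(x, y). d x y) ` M)"
    unfolding cost2_def
    using M finite_covering_matchings[OF assms(1,2)] by (intro Min_le) auto
  ultimately show ?thesis by simp
qed

section \<open>Matchings in the threshold graphs compared with feasible first-stage sets\<close>

lemma matching_Un:
  assumes "matching E M" and "matching F N"
    and "fst ` M \<inter> fst ` N = {}" and "snd ` M \<inter> snd ` N = {}"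
  shows "matching (E \<union> F) (M \<union> N)"
proof -
  \<comment> \<open>This is the form of disjointness that \<open>inj_on_Un\<close> asks for.\<close>
  have "f ` (M - N) \<inter> f ` (N - M) = {}" if "f ` M \<inter> f ` N = {}" for f :: "'a \<times> 'a \<Rightarrow> 'a"
    using that by auto
  then show ?thesis
    using assms by (auto simp: matching_def inj_on_Un)
qed

lemma finite_threshold_edges:
  assumes "finite D" and "finite R1" and "finite S"
  shows "finite (threshold_edges d R1 S D w)"
  by (rule finite_subset[of _ "D \<times> (R1 \<union> S)"]) (use assms in \<open>auto simp: threshold_edges_def\<close>)

text \<open>Split \<open>M\<close> by the side of the rider. The edges at \<open>R1\<close> carry
  all of the weight and bound \<open>cost1\<close>; the edges at \<open>S\<close> have weight 0 but
  length at most \<open>w\<close>, which bounds \<open>cost2\<close>.\<close>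

lemma threshold_matching_candidate:
  fixes d :: "'v \<Rightarrow> 'v \<Rightarrow> real"
  assumes fin: "finite D" "finite R1" "finite S" and disj: "R1 \<inter> S = {}" and "S \<noteq> {}"
    and M: "matching (threshold_edges d R1 S D w) M" and cover: "R1 \<union> S \<subseteq> snd ` M"
    and X: "X = {x. \<exists>y\<in>R1. (x, y) \<in> M}"
  shows "X \<subseteq> D" and "card X = card R1"
    and "total_cost d R1 S D X \<le> 1 / real (card R1) * sum (threshold_weight d R1) M + w"
proof -
  have ME: "M \<subseteq> threshold_edges d R1 S D w" and inj: "inj_on fst M" "inj_on snd M"
    using M by (auto simp: matching_def)
  define M1 where "M1 = {e \<in> M. snd e \<in> R1}"
  define M2 where "M2 = {e \<in> M. snd e \<in> S}"
  show "X \<subseteq> D"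
    using ME disj by (auto simp: X threshold_edges_def)
  have "fst ` M1 = X" by (force simp: X M1_def)
  moreover have "snd ` M1 = R1" using cover by (force simp: M1_def)
  moreover have "inj_on fst M1" "inj_on snd M1"
    using inj by (auto simp: M1_def intro: inj_on_subset)
  moreover have "M1 \<subseteq> fst ` M1 \<times> snd ` M1" by force
  ultimately have M1: "perfect_matching X R1 M1"
    by (simp add: perfect_matching_def matching_def)
  show "card X = card R1" using card_perfect_matching[OF M1] .
  have M2_S: "M2 \<subseteq> {(x, y) \<in> D \<times> S. d x y \<le> w}"
    using ME disj by (auto simp: M2_def threshold_edges_def)
  \<comment> \<open>A driver lies on only one edge of \<open>M\<close>, so it cannot serve riders of
    both \<open>R1\<close> and \<open>S\<close>. The second-stage edges thus use drivers left over
    after the first stage.\<close>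
  have "fst e \<notin> X" if "e \<in> M2" for e
  proof
    assume "fst e \<in> X"
    then obtain y where y: "y \<in> R1" "(fst e, y) \<in> M" by (auto simp: X)
    then have "e = (fst e, y)"
      using that inj_onD[OF inj(1)] by (auto simp: M2_def)
    then show False
      using that y(1) disj by (cases e) (auto simp: M2_def)
  qed
  then have "M2 \<subseteq> (D - X) \<times> S" using M2_S by force
  moreover have "snd ` M2 = S" using cover by (force simp: M2_def)
  moreover have "inj_on fst M2" "inj_on snd M2"
    using inj by (auto simp: M2_def intro: inj_on_subset)
  ultimately have M2: "covering_matching (D - X) S M2"
    by (simp add: covering_matching_def matching_def)
  have "cost2 d (D - X) S \<le> w"
    by (rule cost2_le[OF _ _ _ M2]) (use fin \<open>S \<noteq> {}\<close> M2_S in auto)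
  moreover have "sum (threshold_weight d R1) M = (\<Sum>(x, y)\<in>M1. d x y)"
  proof -
    have "finite M" using finite_matching[OF finite_threshold_edges[OF fin] M] .
    then show ?thesis
      unfolding M1_def threshold_weight_def by (auto simp: sum.inter_filter intro!: sum.cong)
  qed
  moreover have "cost1 d X R1 \<le> 1 / real (card R1) * (\<Sum>(x, y)\<in>M1. d x y)"
    by (rule cost1_le[OF _ _ M1]) (use \<open>X \<subseteq> D\<close> fin finite_subset in auto)
  ultimately show "total_cost d R1 S D X \<le> 1 / real (card R1) * sum (threshold_weight d R1) M + w"
    by (simp add: total_cost_def)
qed

text \<open>This is the converse direction: optimal matchings of both stages for \<open>X\<close>
  are merged. The pair \<open>(x, y)\<close> is an edge attaining the bottleneck, so its distance is
  one of the thresholds tried by the algorithm.\<close>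

lemma threshold_matching_of_solution:
  fixes d :: "'v \<Rightarrow> 'v \<Rightarrow> real"
  assumes fin: "finite D" "finite R1" "finite S" and disj: "R1 \<inter> S = {}" and "S \<noteq> {}"
    and large: "card R1 + card S \<le> card D" and X: "X \<subseteq> D" "card X = card R1"
  obtains x y N where "x \<in> D" and "y \<in> S"
    and "matching (threshold_edges d R1 S D (d x y)) N" and "snd ` N = R1 \<union> S"
    and "1 / real (card R1) * sum (threshold_weight d R1) N + d x y = total_cost d R1 S D X"
proof -
  have "finite X" using X(1) fin(1) finite_subset by blast
  obtain M1 where M1_min: "is_arg_min (sum (\<lambda>(x, y). d x y)) (perfect_matching X R1) M1"
    and c1: "cost1 d X R1 = 1 / real (card R1) * (\<Sum>(x, y)\<in>M1. d x y)"
    using cost1_arg_min[OF \<open>finite X\<close> fin(2) X(2)] .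
  have M1: "perfect_matching X R1 M1" using M1_min by (simp add: is_arg_min_def)
  have "card S \<le> card (D - X)"
    using card_Diff_subset[OF \<open>finite X\<close> X(1)] X(2) large by simp
  then obtain M2 where M2: "covering_matching (D - X) S M2"
    and c2: "cost2 d (D - X) S = Max ((\<lambda>(x, y). d x y) ` M2)"
    using cost2_attained[of "D - X" S] fin by auto
  have finM: "finite M1" "finite M2"
    using M1 M2 fin \<open>finite X\<close> finite_matching[of "X \<times> R1"] finite_matching[of "(D - X) \<times> S"]
    by (auto simp: perfect_matching_def covering_matching_def)
  have "M2 \<noteq> {}" using M2 \<open>S \<noteq> {}\<close> by (auto simp: covering_matching_def)
  then have "Max ((\<lambda>(x, y). d x y) ` M2) \<in> (\<lambda>(x, y). d x y) ` M2"
    using finM by (intro Max_in) auto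
  then obtain x y where xy: "(x, y) \<in> M2" "cost2 d (D - X) S = d x y"
    unfolding c2 by auto
  have M2_le: "d a b \<le> d x y" if "(a, b) \<in> M2" for a b
    using that finM(2) unfolding xy(2)[symmetric] c2 by (force intro: Max_ge)
  have sub: "M1 \<subseteq> X \<times> R1" "M2 \<subseteq> (D - X) \<times> S"
    and img: "snd ` M1 = R1" "snd ` M2 = S"
    using M1 M2 by (auto simp: perfect_matching_def covering_matching_def matching_def)
  \<comment> \<open>The drivers come from \<open>X\<close> and \<open>D - X\<close>, the riders from
    \<open>R1\<close> and \<open>S\<close>, so the two matchings share no endpoint.\<close>
  have "matching (X \<times> R1 \<union> (D - X) \<times> S) (M1 \<union> M2)"
    by (rule matching_Un)
      (use M1 M2 sub disj in \<open>auto simp: perfect_matching_def covering_matching_def\<close>)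
  then have N: "matching (threshold_edges d R1 S D (d x y)) (M1 \<union> M2)"
    using sub X(1) M2_le by (auto simp: matching_def threshold_edges_def)
  have "sum (threshold_weight d R1) (M1 \<union> M2) =
      sum (threshold_weight d R1) M1 + sum (threshold_weight d R1) M2"
    using finM sub disj by (intro sum.union_disjoint) auto
  also have "sum (threshold_weight d R1) M1 = (\<Sum>(x, y)\<in>M1. d x y)"
    using sub by (intro sum.cong) (auto simp: threshold_weight_def)
  also have "sum (threshold_weight d R1) M2 = 0"
    using sub(2) disj by (intro sum.neutral) (fastforce simp: threshold_weight_def)
  finally have "1 / real (card R1) * sum (threshold_weight d R1) (M1 \<union> M2) + d x y =
      total_cost d R1 S D X"
    by (simp add: total_cost_def c1 xy(2))
  moreover have "x \<in> D" "y \<in> S" using xy(1) sub by auto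
  moreover have "snd ` (M1 \<union> M2) = R1 \<union> S" using img by (simp add: image_Un)
  ultimately show thesis using that N by blast
qed

section \<open>Runs of the algorithm and their correctness\<close>

text \<open>This keeps the claim about all runs from being vacuous.\<close>

lemma tsrmb_run_exists:
  assumes "finite D" and "finite R1" and "finite S"
  shows "\<exists>es Ms. tsrmb_run d R1 S D es Ms"
proof -
  let ?f = "\<lambda>(x, y). d x y"
  obtain xs where xs: "set xs = D \<times> S" "distinct xs"
    using finite_distinct_list[of "D \<times> S"] assms by auto
  let ?es = "sort_key ?f xs"
  \<comment> \<open>Matchings are chosen for every natural \<open>i\<close>. Beyond the end of the
    list the threshold is an unspecified real, which does no harm because a suitable matching exists
    for every threshold.\<close>
  have "\<exists>Ms. \<forall>i. min_weight_max_matching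
      (threshold_edges d R1 S D (case ?es ! i of (x, y) \<Rightarrow> d x y)) (threshold_weight d R1) (Ms i)"
    using ex_min_weight_max_matching[OF finite_threshold_edges[OF assms]] by (intro choice) blast
  then obtain Ms where "\<forall>i. min_weight_max_matching
      (threshold_edges d R1 S D (case ?es ! i of (x, y) \<Rightarrow> d x y)) (threshold_weight d R1) (Ms i)" ..
  then have "tsrmb_run d R1 S D ?es Ms"
    using xs by (auto simp: tsrmb_run_def)
  then show ?thesis by blast
qed

theorem lemma2:
  fixes d :: "'v \<Rightarrow> 'v \<Rightarrow> real" and R1 S D :: "'v set"
  assumes "finite D" and "finite R1" and "finite S"
    and "D \<inter> R1 = {}" and "D \<inter> S = {}" and "R1 \<inter> S = {}"
    and "card R1 \<ge> 1" and "S \<noteq> {}"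
    and "Metric_space (R1 \<union> S \<union> D) d"
    and "card D \<ge> card R1 + card S"
  shows "(\<exists>es Ms. tsrmb_run d R1 S D es Ms) \<and>
    (\<forall>es Ms. tsrmb_run d R1 S D es Ms \<longrightarrow>
      (\<exists>D1. tsrmb_returns d R1 S D es Ms D1) \<and>
      (\<forall>D1. tsrmb_returns d R1 S D es Ms D1 \<longrightarrow> optimal_solution d R1 S D D1))"
proof (intro conjI allI impI)
  show "\<exists>es Ms. tsrmb_run d R1 S D es Ms"
    using assms(1-3) by (rule tsrmb_run_exists)
next
  fix es Ms
  assume run: "tsrmb_run d R1 S D es Ms"
  let ?w = "\<lambda>i. case es ! i of (x, y) \<Rightarrow> d x y"
  let ?E = "\<lambda>i. threshold_edges d R1 S D (?w i)"
  let ?cost = "total_cost d R1 S D"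
  let ?cand = "tsrmb_candidate R1 S es Ms"
  have Ms: "min_weight_max_matching (?E i) (threshold_weight d R1) (Ms i)" if "i < length es" for i
    using run that by (simp add: tsrmb_run_def)
  then have matching_Ms: "matching (?E i) (Ms i)" if "i < length es" for i
    using that by (simp add: min_weight_max_matching_def is_arg_min_def is_arg_max_def)
  have feasible: "X \<subseteq> D \<and> card X = card R1" if "?cand X" for X
    using that threshold_matching_candidate(1,2)[OF assms(1-3,6,8) matching_Ms]
    unfolding tsrmb_candidate_def by blast
  \<comment> \<open>Every feasible set is matched or beaten by a candidate; optimality over
    candidates then carries over to all feasible sets.\<close>
  have better: "\<exists>Y. ?cand Y \<and> ?cost Y \<le> ?cost X" if X: "X \<subseteq> D" "card X = card R1" for X
  proof -
    obtain x y N where xy: "x \<in> D" "y \<in> S"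
      and N: "matching (threshold_edges d R1 S D (d x y)) N" "snd ` N = R1 \<union> S"
      and cost: "1 / real (card R1) * sum (threshold_weight d R1) N + d x y = ?cost X"
      using threshold_matching_of_solution[OF assms(1-3,6,8,10) X] .
    \<comment> \<open>The bottleneck pair is enumerated at some index \<open>i\<close>, whose graph
      has exactly the threshold \<open>d x y\<close> and hence contains \<open>N\<close>.\<close>
    have "(x, y) \<in> set es" using xy run by (simp add: tsrmb_run_def)
    then obtain i where i: "i < length es" "es ! i = (x, y)"
      by (auto simp: in_set_conv_nth)
    then have w: "?w i = d x y" by simp
    have "snd ` ?E i \<subseteq> R1 \<union> S" by (auto simp: threshold_edges_def)
    \<comment> \<open>With \<open>V\<close> taken as \<open>R1 \<union> S\<close>, the existence of
      \<open>N\<close> shows that index \<open>i\<close> is not discarded and that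
      \<open>Ms i\<close> weighs no more than \<open>N\<close>.\<close>
    note M = min_weight_max_matching_covers[OF finite_threshold_edges[OF assms(1-3)] this _ Ms[OF i(1)] N(1)[folded w] N(2)]
    define Y where "Y = {x. \<exists>y\<in>R1. (x, y) \<in> Ms i}"
    have cover: "R1 \<union> S \<subseteq> snd ` Ms i" using M(1) assms(2,3) by simp
    then have "?cand Y" using i(1) by (auto simp: tsrmb_candidate_def Y_def)
    have "?cost Y \<le> 1 / real (card R1) * sum (threshold_weight d R1) (Ms i) + ?w i"
      by (rule threshold_matching_candidate(3)[OF assms(1-3,6,8) matching_Ms[OF i(1)] cover Y_def])
    also have "\<dots> \<le> 1 / real (card R1) * sum (threshold_weight d R1) N + ?w i"
      using M(2) assms(2,3) by (intro add_right_mono mult_left_mono) auto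
    also have "\<dots> = ?cost X" unfolding w by (rule cost)
    finally show ?thesis using \<open>?cand Y\<close> by blast
  qed
  show "\<exists>D1. tsrmb_returns d R1 S D es Ms D1"
  proof -
    \<comment> \<open>Some feasible set exists because \<open>D\<close> is large enough; the
      candidate that dominates it shows that not all indices are discarded.\<close>
    obtain X where "X \<subseteq> D" "card X = card R1"
      using obtain_subset_with_card_n[of "card R1" D] assms(10) by auto
    then obtain Y where "?cand Y" using better by blast
    moreover have "finite {X. ?cand X}"
      by (rule finite_subset[of _ "Pow D"]) (use feasible assms(1) in auto)
    ultimately show ?thesis
      unfolding tsrmb_returns_def by (rule ex_is_arg_min_Collect[rotated])
  qed
  fix D1
  assume "tsrmb_returns d R1 S D es Ms D1"
  then have D1: "?cand D1" and D1_min: "\<And>Y. ?cand Y \<Longrightarrow> ?cost D1 \<le> ?cost Y"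
    by (auto simp: tsrmb_returns_def is_arg_min_linorder)
  then show "optimal_solution d R1 S D D1"
    unfolding optimal_solution_def is_arg_min_linorder
    using feasible[OF D1] better D1_min by (meson order_trans)
qed

end
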